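(* Let $n\ge0$ be an integer. The function $f_n(x)=\sqrt x\,e^{-x}I_n(x)$ is increasing in $x$ when $x\in B_n$, where $B_n=[0,n+1/2]$ if $n=0,1$ and $B_n=[0,\infty)$ if $n\ge2$.
   Context: $I_n$ denotes the modified Bessel function of the first kind of integer order $n$. *)

theory Defs
  imports Complex_Main
begin

text \<open>
  Modified Bessel function of the first kind, of nonnegative integer order and real argument,
  by its everywhere convergent power series; \<open>fact (k + n)\<close> is \<open>\<Gamma>(k + n + 1)\<close>.
\<close>
definition bessel_I :: "nat \<Rightarrow> real \<Rightarrow> real" where
  "bessel_I n x = (\<Sum>k. (x / 2) ^ (2 * k + n) / (fact k * fact (k + n)))"

lemma summable_bessel_I:
  "summable (\<lambda>k. (x / 2) ^ (2 * k + n) / (fact k * fact (k + n)) :: real)"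
proof (rule summable_comparison_test)
  have "summable (\<lambda>k. inverse (fact k) * ((x / 2)\<^sup>2) ^ k :: real)"
    by (rule summable_exp)
  then show "summable (\<lambda>k. \<bar>x / 2\<bar> ^ n * (inverse (fact k) * ((x / 2)\<^sup>2) ^ k))"
    by (rule summable_mult)
  have "norm ((x / 2) ^ (2 * k + n) / (fact k * fact (k + n)))
      \<le> \<bar>x / 2\<bar> ^ n * (inverse (fact k) * ((x / 2)\<^sup>2) ^ k)" for k
  proof -
    have "\<bar>x / 2\<bar> ^ (2 * k) = (\<bar>x / 2\<bar>\<^sup>2) ^ k"
      by (rule power_mult)
    then have pow: "\<bar>(x / 2) ^ (2 * k + n)\<bar> = \<bar>x / 2\<bar> ^ n * ((x / 2)\<^sup>2) ^ k"
      by (simp only: power_add power_abs power2_abs abs_mult) (simp only: mult.commute)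
    have "(fact k :: real) * 1 \<le> fact k * fact (k + n)"
      by (intro mult_left_mono fact_ge_1) simp
    then have "\<bar>(x / 2) ^ (2 * k + n)\<bar> / (fact k * fact (k + n)) \<le> \<bar>(x / 2) ^ (2 * k + n)\<bar> / fact k"
      by (intro divide_left_mono) auto
    also have "\<dots> = \<bar>x / 2\<bar> ^ n * (inverse (fact k) * ((x / 2)\<^sup>2) ^ k)"
      unfolding pow by (simp only: divide_inverse mult_ac)
    finally show ?thesis
      by (simp only: real_norm_def abs_divide abs_of_pos[OF mult_pos_pos[OF fact_gt_zero fact_gt_zero]])
  qed
  then show "\<exists>N. \<forall>k\<ge>N. norm ((x / 2) ^ (2 * k + n) / (fact k * fact (k + n)))
      \<le> \<bar>x / 2\<bar> ^ n * (inverse (fact k) * ((x / 2)\<^sup>2) ^ k)"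
    by blast
qed

definition B_set :: "nat \<Rightarrow> real set" where
  "B_set n = (if n = 0 \<or> n = 1 then {0 .. real n + 1 / 2} else {0 ..})"

definition f_fun :: "nat \<Rightarrow> real \<Rightarrow> real" where
  "f_fun n x = sqrt x * exp (- x) * bessel_I n x"

end

theory Submission
  imports Defs
begin

text \<open>
  Write \<open>f = f_fun n\<close>, \<open>I = bessel_I\<close> and \<open>w x = sqrt x * I n x\<close>, so that \<open>f x = exp (- x) * w x\<close>
  and \<open>f' = exp (- x) * (w' - w)\<close>; the task is to show \<open>w' > w\<close> for
  positive \<open>x\<close> in \<open>B_set n\<close>. Since \<open>I n' = n / x * I n + I (n + 1)\<close>, the difference \<open>w' - w\<close>
  is \<open>sqrt x\<close> times the quantity \<open>drift\<close> below,
  \<open>((n + 1/2) / x - 1) * I n x + I (n + 1) x\<close>. Two observations settle its sign.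

  For \<open>x \<le> n + 1/2\<close> both summands are nonnegative and the second one is positive. This is all that
  is needed when \<open>n = 0\<close>.

  For larger \<open>x\<close> and \<open>n \<ge> 1\<close>, removing the first-order term from Bessel's equation gives
  \<open>w'' = (1 + (n\<^sup>2 - 1/4) / x\<^sup>2) * w\<close>, whence
  \<open>(exp x * (w' - w))' = exp x * (w'' - w) = exp x * (n\<^sup>2 - 1/4) / x\<^sup>2 * w > 0\<close>.
  So \<open>exp x * (w' - w)\<close>, which is positive at \<open>n + 1/2\<close>, stays positive from there on.

  The second derivative of \<open>w\<close> never has to be formed: the pair \<open>(I n, I (n + 1))\<close> solves a
  first-order linear system, which is read off from the power series.
\<close>

section \<open>The entire function underlying the Bessel function\<close>

text \<open>
  Factoring \<open>(x / 2) ^ n\<close> out of the Bessel series leaves a genuine power series in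
  \<open>t = (x / 2)\<^sup>2\<close>, so that the theorems on termwise differentiation apply to it.
\<close>
definition bessel_clifford :: "nat \<Rightarrow> real \<Rightarrow> real" where
  "bessel_clifford n t = (\<Sum>k. 1 / (fact k * fact (k + n)) * t ^ k)"

lemma summable_bessel_clifford:
  fixes t :: real
  shows "summable (\<lambda>k. 1 / (fact k * fact (k + n)) * t ^ k)"
proof (rule summable_comparison_test')
  show "summable (\<lambda>k. inverse (fact k) * \<bar>t\<bar> ^ k)"
    by (rule summable_exp)
  fix k :: nat
  have "(fact k :: real) * 1 \<le> fact k * fact (k + n)"
    by (intro mult_left_mono fact_ge_1) simp
  then have "1 / (fact k * fact (k + n) :: real) \<le> inverse (fact k)"
    by (simp add: divide_simps)
  from mult_right_mono[OF this, of "\<bar>t\<bar> ^ k"]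
  show "norm (1 / (fact k * fact (k + n)) * t ^ k) \<le> inverse (fact k) * \<bar>t\<bar> ^ k"
    by (simp add: abs_mult power_abs)
qed

lemma bessel_I_eq_bessel_clifford:
  "bessel_I n x = (x / 2) ^ n * bessel_clifford n ((x / 2)\<^sup>2)"
proof -
  have "(x / 2) ^ n * bessel_clifford n ((x / 2)\<^sup>2)
      = (\<Sum>k. (x / 2) ^ n * (1 / (fact k * fact (k + n)) * ((x / 2)\<^sup>2) ^ k))"
    unfolding bessel_clifford_def by (rule suminf_mult[symmetric, OF summable_bessel_clifford])
  also have "\<dots> = bessel_I n x"
    unfolding bessel_I_def
  proof (rule suminf_cong)
    fix k
    have "(x / 2) ^ (2 * k + n) = (x / 2) ^ n * ((x / 2)\<^sup>2) ^ k"
      by (simp add: power_add power_mult)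
    then show "(x / 2) ^ n * (1 / (fact k * fact (k + n)) * ((x / 2)\<^sup>2) ^ k)
        = (x / 2) ^ (2 * k + n) / (fact k * fact (k + n))"
      by (simp only: times_divide_eq_left times_divide_eq_right mult_1)
  qed
  finally show ?thesis ..
qed

lemma has_real_derivative_bessel_clifford:
  "(bessel_clifford n has_real_derivative bessel_clifford (Suc n) t) (at t)"
proof -
  have "((\<lambda>t. \<Sum>k. 1 / (fact k * fact (k + n)) * t ^ k) has_real_derivative
      (\<Sum>k. diffs (\<lambda>k. 1 / (fact k * fact (k + n))) k * t ^ k)) (at t)"
    by (rule termdiffs_strong_converges_everywhere) (rule summable_bessel_clifford)
  moreover have "diffs (\<lambda>k. 1 / (fact k * fact (k + n)) :: real)
      = (\<lambda>k. 1 / (fact k * fact (k + Suc n)))"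
    by (rule ext) (simp add: diffs_def divide_simps del: of_nat_Suc)
  ultimately show ?thesis
    by (simp add: bessel_clifford_def[abs_def])
qed

text \<open>
  Comparing coefficients of \<open>t ^ k\<close>, this is \<open>n + 1 + k = (n + 1) + k\<close> divided by
  \<open>k! * (k + n + 1)!\<close>; the last series enters shifted by one index.
\<close>
lemma bessel_clifford_recurrence:
  "bessel_clifford n t
    = real (Suc n) * bessel_clifford (Suc n) t + t * bessel_clifford (Suc (Suc n)) t"
proof -
  let ?c = "\<lambda>n k. 1 / (fact k * fact (k + n)) :: real"
  let ?d = "\<lambda>k. case k of 0 \<Rightarrow> 0 | Suc j \<Rightarrow> ?c (Suc (Suc n)) j * t ^ Suc j"
  have sums: "(\<lambda>k. ?c n k * t ^ k) sums bessel_clifford n t" for n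
    unfolding bessel_clifford_def by (rule summable_sums[OF summable_bessel_clifford])
  have "(\<lambda>k. ?d (Suc k)) sums (t * bessel_clifford (Suc (Suc n)) t)"
    using sums_mult[OF sums[of "Suc (Suc n)"], of t]
    by (simp only: nat.case power_Suc mult_ac)
  then have "?d sums (t * bessel_clifford (Suc (Suc n)) t)"
    using sums_Suc_iff[of ?d] by simp
  then have "(\<lambda>k. real (Suc n) * (?c (Suc n) k * t ^ k) + ?d k) sums
      (real (Suc n) * bessel_clifford (Suc n) t + t * bessel_clifford (Suc (Suc n)) t)"
    by (intro sums_add sums_mult sums)
  moreover have "real (Suc n) * (?c (Suc n) k * t ^ k) + ?d k = ?c n k * t ^ k" for k
  proof (cases k)
    case 0
    then show ?thesis by (simp add: divide_simps)
  next
    case (Suc j)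
    have "real (Suc n) * ?c (Suc n) (Suc j) + ?c (Suc (Suc n)) j = ?c n (Suc j)"
      by (simp add: divide_simps)
    then have "(real (Suc n) * ?c (Suc n) (Suc j) + ?c (Suc (Suc n)) j) * t ^ Suc j
        = ?c n (Suc j) * t ^ Suc j"
      by (rule arg_cong)
    then show ?thesis
      unfolding Suc by (simp only: nat.case distrib_right mult.assoc)
  qed
  ultimately show ?thesis
    using sums[of n] by (simp add: sums_unique2)
qed

lemma bessel_clifford_pos:
  assumes "t \<ge> 0"
  shows "bessel_clifford n t > 0"
  unfolding bessel_clifford_def
proof (rule suminf_pos2[where i = 0, OF summable_bessel_clifford])
  show "0 \<le> 1 / (fact k * fact (k + n)) * t ^ k" for k
    using assms by simp
qed simp

section \<open>The first-order system for consecutive Bessel functions\<close>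

lemma bessel_I_pos:
  assumes "x > 0"
  shows "bessel_I n x > 0"
  using assms by (simp add: bessel_I_eq_bessel_clifford bessel_clifford_pos)

lemma bessel_I_recurrence:
  assumes "x \<noteq> 0"
  shows "bessel_I (Suc (Suc n)) x = bessel_I n x - 2 * real (Suc n) / x * bessel_I (Suc n) x"
  unfolding bessel_I_eq_bessel_clifford bessel_clifford_recurrence[of n]
  using assms by (simp add: field_simps power2_eq_square)

lemma has_real_derivative_bessel_I:
  assumes "x \<noteq> 0"
  shows "(bessel_I n has_real_derivative (real n / x * bessel_I n x + bessel_I (Suc n) x)) (at x)"
proof -
  have inner: "((\<lambda>x. (x / 2)\<^sup>2) has_real_derivative x / 2) (at x)"
    by (auto intro!: derivative_eq_intros)
  have pow: "((\<lambda>x. (x / 2) ^ n) has_real_derivative real n / x * (x / 2) ^ n) (at x)"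
  proof (cases n)
    case (Suc m)
    have "((\<lambda>x. (x / 2) ^ Suc m) has_real_derivative (1 + real m) * (1 / 2 * (x / 2) ^ m)) (at x)"
      by (intro DERIV_power_Suc DERIV_cdivide DERIV_ident)
    then show ?thesis
      unfolding Suc by (rule DERIV_cong) (use assms in \<open>simp add: field_simps\<close>)
  qed simp
  have "((\<lambda>x. (x / 2) ^ n * bessel_clifford n ((x / 2)\<^sup>2)) has_real_derivative
      (real n / x * (x / 2) ^ n) * bessel_clifford n ((x / 2)\<^sup>2)
      + (bessel_clifford (Suc n) ((x / 2)\<^sup>2) * (x / 2)) * (x / 2) ^ n) (at x)"
    by (rule DERIV_mult[OF pow DERIV_chain2[OF has_real_derivative_bessel_clifford inner]])
  then show ?thesis
    unfolding bessel_I_eq_bessel_clifford[abs_def] by (simp add: mult_ac)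
qed

lemma has_real_derivative_bessel_I_Suc:
  assumes "x \<noteq> 0"
  shows "(bessel_I (Suc n) has_real_derivative
    (bessel_I n x - real (Suc n) / x * bessel_I (Suc n) x)) (at x)"
  by (rule DERIV_cong[OF has_real_derivative_bessel_I[OF assms]])
    (simp add: bessel_I_recurrence[OF assms] field_simps)

lemma isCont_bessel_I: "isCont (bessel_I n) x"
proof -
  have "isCont (\<lambda>x. bessel_clifford n ((x / 2)\<^sup>2)) x"
    by (rule isCont_o2[OF _ DERIV_isCont[OF has_real_derivative_bessel_clifford]]) simp
  then show ?thesis
    unfolding bessel_I_eq_bessel_clifford[abs_def] by (intro continuous_intros) simp_all
qed

section \<open>The sign of the derivative\<close>

definition drift :: "nat \<Rightarrow> real \<Rightarrow> real" where
  "drift n x = ((real n + 1 / 2) / x - 1) * bessel_I n x + bessel_I (Suc n) x"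

text \<open>
  The usual \<open>1 / (2 * sqrt x)\<close>, rewritten so that \<open>sqrt x\<close> factors out of the derivatives of
  \<open>f_fun n\<close> and of \<open>exp x * (w' - w)\<close>.
\<close>
lemma has_real_derivative_sqrt:
  assumes "x > 0"
  shows "(sqrt has_real_derivative sqrt x / (2 * x)) (at x)"
proof (rule DERIV_cong[OF DERIV_real_sqrt[OF assms]])
  have "sqrt x * sqrt x = x" "sqrt x > 0"
    using assms by simp_all
  then show "inverse (sqrt x) / 2 = sqrt x / (2 * x)"
    using assms by (simp add: divide_simps)
qed

lemma has_real_derivative_f_fun:
  assumes "x > 0"
  shows "(f_fun n has_real_derivative (sqrt x * exp (- x) * drift n x)) (at x)"
  unfolding f_fun_def[abs_def] drift_def using assms
  by (auto intro!: derivative_eq_intros has_real_derivative_sqrt has_real_derivative_bessel_I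
      simp: field_simps)

lemma drift_pos_if_le:
  assumes "0 < x" "x \<le> real n + 1 / 2"
  shows "drift n x > 0"
proof -
  have "0 \<le> ((real n + 1 / 2) / x - 1) * bessel_I n x"
    using assms bessel_I_pos[OF assms(1), of n] by (intro mult_nonneg_nonneg) (auto simp: field_simps)
  then show ?thesis
    unfolding drift_def using bessel_I_pos[OF assms(1), of "Suc n"] by linarith
qed

text \<open>
  The left-hand function is \<open>exp x * (w' - w)\<close> for \<open>w x = sqrt x * bessel_I n x\<close>. The factor
  \<open>exp x\<close> is chosen so that the first derivatives of \<open>w\<close> cancel, and \<open>n\<^sup>2 - 1/4\<close> is the constant
  in the normal form of Bessel's equation.
\<close>
lemma has_real_derivative_weighted_drift:
  assumes "x > 0"
  shows "((\<lambda>x. sqrt x * exp x * drift n x) has_real_derivative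
    (sqrt x * exp x * ((real n)\<^sup>2 - 1 / 4) / x\<^sup>2 * bessel_I n x)) (at x)"
proof -
  have nz: "x \<noteq> 0" using assms by simp
  have coeff: "((\<lambda>x. (real n + 1 / 2) / x - 1) has_real_derivative - (real n + 1 / 2) / x\<^sup>2) (at x)"
    using nz by (auto intro!: derivative_eq_intros simp: power2_eq_square)
  have drift: "(drift n has_real_derivative
      - (real n + 1 / 2) / x\<^sup>2 * bessel_I n x
      + (real n / x * bessel_I n x + bessel_I (Suc n) x) * ((real n + 1 / 2) / x - 1)
      + (bessel_I n x - real (Suc n) / x * bessel_I (Suc n) x)) (at x)"
    unfolding drift_def[abs_def]
    by (rule DERIV_add[OF DERIV_mult[OF coeff has_real_derivative_bessel_I[OF nz]]
          has_real_derivative_bessel_I_Suc[OF nz]])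
  show ?thesis
    by (rule DERIV_cong[OF DERIV_mult[OF DERIV_mult[OF has_real_derivative_sqrt[OF assms] DERIV_exp] drift]])
      (use nz in \<open>simp add: drift_def field_simps power2_eq_square\<close>)
qed

lemma drift_pos:
  assumes "n \<ge> 1" "x > 0"
  shows "drift n x > 0"
proof (cases "x \<le> real n + 1 / 2")
  case True
  with assms show ?thesis by (intro drift_pos_if_le)
next
  case False
  let ?h = "\<lambda>x. sqrt x * exp x * drift n x"
  let ?a = "real n + 1 / 2"
  have "0 < ?h ?a"
    by (intro mult_pos_pos drift_pos_if_le) (auto intro: add_nonneg_pos)
  also have "?h ?a < ?h x"
  proof (rule DERIV_pos_imp_increasing[where f = ?h])
    show "?a < x" using False by simp
    fix y assume "?a \<le> y"
    then have "y > 0" using assms(1) by linarith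
    have "(real n)\<^sup>2 \<ge> 1"
      using assms(1) by (intro one_le_power) simp
    then have "0 < sqrt y * exp y * ((real n)\<^sup>2 - 1 / 4) / y\<^sup>2 * bessel_I n y"
      using \<open>y > 0\<close> bessel_I_pos[OF \<open>y > 0\<close>, of n]
      by (intro mult_pos_pos divide_pos_pos) auto
    with has_real_derivative_weighted_drift[OF \<open>y > 0\<close>, of n]
    show "\<exists>d. (?h has_real_derivative d) (at y) \<and> 0 < d" by blast
  qed
  finally show ?thesis
    by (rule zero_less_mult_pos) (use assms(2) in simp)
qed

section \<open>Monotonicity\<close>

theorem proposition8p4:
  fixes n :: nat
  shows "strict_mono_on (B_set n) (f_fun n)"
proof (rule strict_mono_onI)
  fix a b assume ab: "a \<in> B_set n" "b \<in> B_set n" "a < b"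
  show "f_fun n a < f_fun n b"
  \<comment> \<open>The square root is merely continuous at the possible left end point \<open>0\<close>; hence the
     monotonicity criterion that asks for a derivative in the open interval only.\<close>
  proof (rule DERIV_pos_imp_increasing_open[OF ab(3)])
    fix x assume x: "a < x" "x < b"
    with ab have "x > 0"
      by (auto simp: B_set_def split: if_splits)
    have "drift n x > 0"
    proof (cases "n = 0")
      case True
      with ab x \<open>x > 0\<close> show ?thesis
        by (intro drift_pos_if_le) (auto simp: B_set_def)
    next
      case False
      with \<open>x > 0\<close> show ?thesis by (intro drift_pos) auto
    qed
    then have "0 < sqrt x * exp (- x) * drift n x"
      using \<open>x > 0\<close> by simp
    with has_real_derivative_f_fun[OF \<open>x > 0\<close>, of n]
    show "\<exists>d. (f_fun n has_real_derivative d) (at x) \<and> 0 < d" by blast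
  next
    show "continuous_on {a..b} (f_fun n)"
      unfolding f_fun_def[abs_def]
      by (intro continuous_intros continuous_at_imp_continuous_on ballI isCont_bessel_I)
  qed
qed

end
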